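(* Let $R=\mathbb{C}[x,y]$ and let $J=I_\mu\subset R$ be a monomial ideal of finite colength $n$, with associated partition $\mu$, so that the corresponding subscheme is supported at the origin. Then the vector space $$I_\mu/(x,y)I_\mu$$ has a basis given by the images of the minimal monomial generators of $I_\mu$. Equivalently, these basis vectors are indexed by the addable boxes of $D(\mu)$. Consequently, the torus-fixed points in the fibre $\phi^{-1}(I_\mu,0)$ of the morphism $\phi:S^{[n,n+1]}\to S^{[n]}\times S$, $\phi(I\subset J)=(J,\operatorname{res}(I,J))$, correspond to the addable boxes of $\mu$.
   Context: All schemes are over $\mathbb{C}$, $S=\mathbb{A}^2_{\mathbb{C}}=\operatorname{Spec}R$. A partition is a finite nonincreasing sequence of positive integers $\mu=(\mu_0\ge\cdots\ge\mu_{r-1}>0)$; its Young diagram is $D(\mu)=\{(i,j)\in\mathbb{N}^2:0\le j<r,\ 0\le i<\mu_j\}$ (with $0\in\mathbb{N}$), and $I_\mu=\langle x^iy^j:(i,j)\notin D(\mu)\rangle$. Every monomial ideal of finite colength $n$ is $I_\mu$ for a unique partition $\mu$ of $n$. A box $a\in\mathbb{N}^2\setminus D(\mu)$ is addable if $D(\mu)\cup\{a\}$ is again the Young diagram of a partition; a box $(i,j)$ corresponds to the monomial $x^iy^j$. $S^{[n]}=\operatorname{Hilb}^n(S)$ is the Hilbert scheme of $n$ points; its closed points are ideals of $R$ of colength $n$. The nested Hilbert scheme $S^{[n,n+1]}\subset S^{[n+1]}\times S^{[n]}$ is the closed incidence subscheme of pairs $(Z,Y)$ with $Y\subset Z$;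 its closed points are pairs of ideals $I\subset J\subset R$ of colengths $n+1$ and $n$. For such a pair, $J/I\cong R/\mathfrak{m}_p$ for a unique closed point $p\in S$ with maximal ideal $\mathfrak{m}_p$, called the residual point $\operatorname{res}(I,J)$. The torus $T=(\mathbb{C}^\times)^2$ acts on $S$ by $(q,t)\cdot(a,b)=(qa,tb)$, on $R$ by $((q,t)\cdot f)(x,y)=f(q^{-1}x,t^{-1}y)$, and on ideals by $\tau\cdot I=\{\tau\cdot f:f\in I\}$; this induces actions on $S^{[n]}$ and $S^{[n,n+1]}$ for which $\phi$ is equivariant, and $(I_\mu,0)$ is a fixed point. *)

theory Defs
  imports
    "HOL-Library.Poly_Mapping"
    "HOL-Library.Product_Plus"
    "HOL-Algebra.Ideal_Product"
    "Jordan_Normal_Form.VS_Connect"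
begin

section \<open>The polynomial ring in two variables\<close>

text \<open>
  \<open>\<complex>[x,y]\<close> is the monoid algebra of \<open>\<nat>\<^sup>2\<close>: a finitely supported map sends the exponent
  \<open>(i,j)\<close> to the coefficient of \<open>x\<^sup>i y\<^sup>j\<close>, and multiplication is convolution.
\<close>

type_synonym poly_xy = "(nat \<times> nat) \<Rightarrow>\<^sub>0 complex"

abbreviation Rxy :: "poly_xy ring" where
  "Rxy \<equiv> class_ring"

definition xy_monom :: "nat \<times> nat \<Rightarrow> poly_xy" where
  "xy_monom a = Poly_Mapping.single a 1"

definition const_xy :: "complex \<Rightarrow> poly_xy" where
  "const_xy c = Poly_Mapping.single (0, 0) c"

abbreviation var_x :: poly_xy where "var_x \<equiv> xy_monom (1, 0)"
abbreviation var_y :: poly_xy where "var_y \<equiv> xy_monom (0, 1)"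

text \<open>\<open>f(u,v)\<close>, where \<open>\<iota>\<close> maps the coefficients into the ring containing \<open>u\<close> and \<open>v\<close>.\<close>

definition subst_xy :: "(complex \<Rightarrow> 'a::comm_semiring_1) \<Rightarrow> poly_xy \<Rightarrow> 'a \<Rightarrow> 'a \<Rightarrow> 'a" where
  "subst_xy \<iota> f u v =
     (\<Sum>(i, j)\<in>Poly_Mapping.keys f. \<iota> (Poly_Mapping.lookup f (i, j)) * u ^ i * v ^ j)"

definition eval_xy :: "poly_xy \<Rightarrow> complex \<times> complex \<Rightarrow> complex" where
  "eval_xy f p = subst_xy (\<lambda>c. c) f (fst p) (snd p)"

definition zero_locus :: "poly_xy set \<Rightarrow> (complex \<times> complex) set" where
  "zero_locus I = {p. \<forall>f\<in>I. eval_xy f p = 0}"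

definition max_ideal :: "complex \<times> complex \<Rightarrow> poly_xy set" where
  "max_ideal p = {f. eval_xy f p = 0}"


section \<open>Quotients and colength\<close>

text \<open>
  The quotient \<open>M/N\<close> for \<open>N \<subseteq> M \<subseteq> \<complex>[x,y]\<close>, with elements the cosets \<open>N + f\<close> for \<open>f \<in> M\<close>, and
  with scalars acting on representatives by \<open>sc\<close>: it is a complex vector space for
  \<open>sc = scale_xy\<close> and a \<open>\<complex>[x,y]\<close>-module for \<open>sc = (*)\<close>.  The record type of modules extends that of
  rings; the fields \<open>mult\<close> and \<open>one\<close> play no role in modules.
\<close>

definition quot_mod ::
  "('k \<Rightarrow> poly_xy \<Rightarrow> poly_xy) \<Rightarrow> poly_xy set \<Rightarrow> poly_xy set \<Rightarrow> ('k, poly_xy set) module" where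
  "quot_mod sc M N =
     \<lparr> carrier = (\<lambda>f. N +>\<^bsub>Rxy\<^esub> f) ` M, mult = undefined, one = undefined,
       zero = N, add = set_add Rxy,
       smult = (\<lambda>c A. \<Union>f\<in>A. N +>\<^bsub>Rxy\<^esub> sc c f) \<rparr>"

definition scale_xy :: "complex \<Rightarrow> poly_xy \<Rightarrow> poly_xy" where
  "scale_xy c f = const_xy c * f"

abbreviation quot_space :: "poly_xy set \<Rightarrow> poly_xy set \<Rightarrow> (complex, poly_xy set) module" where
  "quot_space \<equiv> quot_mod scale_xy"

abbreviation quot_Rmod :: "poly_xy set \<Rightarrow> poly_xy set \<Rightarrow> (poly_xy, poly_xy set) module" where
  "quot_Rmod \<equiv> quot_mod (*)"

definition iso_Rmod ::
  "(poly_xy, 'a) module \<Rightarrow> (poly_xy, 'b) module \<Rightarrow> bool" where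
  "iso_Rmod M N \<longleftrightarrow> (\<exists>h\<in>LinearCombinations.module_hom Rxy M N. bij_betw h (carrier M) (carrier N))"

definition has_colength :: "poly_xy set \<Rightarrow> nat \<Rightarrow> bool" where
  "has_colength I n \<longleftrightarrow>
     vectorspace.fin_dim class_ring (quot_space UNIV I) \<and>
     vectorspace.dim class_ring (quot_space UNIV I) = n"


section \<open>Partitions and monomial ideals\<close>

definition is_partition :: "nat list \<Rightarrow> bool" where
  "is_partition \<mu> \<longleftrightarrow> sorted_wrt (\<ge>) \<mu> \<and> (\<forall>k\<in>set \<mu>. 0 < k)"

definition young_diagram :: "nat list \<Rightarrow> (nat \<times> nat) set" where
  "young_diagram \<mu> = {(i, j). j < length \<mu> \<and> i < \<mu> ! j}"

definition addable_boxes :: "nat list \<Rightarrow> (nat \<times> nat) set" where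
  "addable_boxes \<mu> =
     {a. a \<notin> young_diagram \<mu> \<and>
         (\<exists>\<nu>. is_partition \<nu> \<and> young_diagram \<nu> = insert a (young_diagram \<mu>))}"

definition ideal_outside :: "(nat \<times> nat) set \<Rightarrow> poly_xy set" where
  "ideal_outside D = genideal Rxy (xy_monom ` (- D))"

definition partition_ideal :: "nat list \<Rightarrow> poly_xy set" where
  "partition_ideal \<mu> = ideal_outside (young_diagram \<mu>)"

definition m_times :: "poly_xy set \<Rightarrow> poly_xy set" where
  "m_times I = ideal_prod Rxy (genideal Rxy {var_x, var_y}) I"

definition is_min_monomial_gens :: "poly_xy set \<Rightarrow> poly_xy set \<Rightarrow> bool" where
  "is_min_monomial_gens I G \<longleftrightarrow>
     G \<subseteq> range xy_monom \<and> genideal Rxy G = I \<and> (\<forall>H. H \<subset> G \<longrightarrow> genideal Rxy H \<noteq> I)"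

text \<open>
  A monomial ideal has exactly one generating set of monomials that is minimal under inclusion;
  its members are the minimal monomial generators.
\<close>

definition min_monomial_gens :: "poly_xy set \<Rightarrow> poly_xy set" where
  "min_monomial_gens I = (THE G. is_min_monomial_gens I G)"


section \<open>Closed points of the (nested) Hilbert scheme and the torus action\<close>

definition hilb :: "nat \<Rightarrow> poly_xy set set" where
  "hilb n = {I. ideal I Rxy \<and> has_colength I n}"

definition nested_hilb :: "nat \<Rightarrow> (poly_xy set \<times> poly_xy set) set" where
  "nested_hilb n = {(I, J). I \<in> hilb (n + 1) \<and> J \<in> hilb n \<and> I \<subseteq> J}"

text \<open>
  For \<open>(I, J)\<close> in the nested Hilbert scheme, \<open>J/I\<close> is one-dimensional, so there is exactly one such
  point; on other pairs the value is irrelevant.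
\<close>

definition residual_point :: "poly_xy set \<Rightarrow> poly_xy set \<Rightarrow> complex \<times> complex" where
  "residual_point I J = (THE p. iso_Rmod (quot_Rmod J I) (quot_Rmod UNIV (max_ideal p)))"

definition hilb_phi ::
  "poly_xy set \<times> poly_xy set \<Rightarrow> poly_xy set \<times> (complex \<times> complex)" where
  "hilb_phi = (\<lambda>(I, J). (J, residual_point I J))"

definition phi_fibre ::
  "nat \<Rightarrow> poly_xy set \<times> (complex \<times> complex) \<Rightarrow> (poly_xy set \<times> poly_xy set) set" where
  "phi_fibre n z = {P \<in> nested_hilb n. hilb_phi P = z}"

definition torus :: "(complex \<times> complex) set" where
  "torus = {(q, t). q \<noteq> 0 \<and> t \<noteq> 0}"

definition torus_act :: "complex \<times> complex \<Rightarrow> poly_xy \<Rightarrow> poly_xy" where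
  "torus_act = (\<lambda>(q, t) f.
     subst_xy const_xy f (const_xy (inverse q) * var_x) (const_xy (inverse t) * var_y))"

definition torus_act_pair ::
  "complex \<times> complex \<Rightarrow> poly_xy set \<times> poly_xy set \<Rightarrow> poly_xy set \<times> poly_xy set" where
  "torus_act_pair \<tau> = (\<lambda>(I, J). (torus_act \<tau> ` I, torus_act \<tau> ` J))"

definition torus_fixed :: "(poly_xy set \<times> poly_xy set) set \<Rightarrow> (poly_xy set \<times> poly_xy set) set" where
  "torus_fixed X = {P \<in> X. \<forall>\<tau>\<in>torus. torus_act_pair \<tau> P = P}"

end

theory Submission
  imports Defs
begin

text \<open>
  Write \<open>U\<close> for the complement of the Young diagram in \<open>\<nat>\<^sup>2\<close>, an up-closed set of exponents.  The
  ideal \<open>J = I\<^sub>\<mu>\<close> is the linear span of the monomials with exponent in \<open>U\<close>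
  (\<open>ideal_outside_eq_monom_span\<close>), so questions about \<open>J\<close> become questions about subsets of \<open>\<nat>\<^sup>2\<close>.
  Multiplication by \<open>x\<close> and \<open>y\<close> reaches exactly the non-minimal elements of \<open>U\<close>
  (\<open>m_times_monom_span\<close>), and in a quotient of two such spans the remaining monomials form a basis
  (\<open>basis_monomial_cosets\<close>).  Hence \<open>J/(x,y)J\<close> has as basis the monomials with minimal exponent.
  These are the minimal monomial generators (\<open>min_monomial_gens_monom_span\<close>), and removing a point
  from \<open>U\<close> leaves an up-closed set precisely when the point is minimal, so minimal exponents are the
  addable boxes (\<open>addable_boxes_eq_min_exponents\<close>).

  For the fibre, an ideal stable under the torus contains every monomial that occurs in one of its
  elements, because distinct exponents have distinct characters
  (\<open>torus_stable_ideal_eq_monom_span\<close>).  A fixed point of the fibre is therefore a pair \<open>(I, J)\<close>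
  with \<open>I\<close> spanned by the monomials of an up-closed \<open>W \<subseteq> U\<close>.  Colength counts the exponents outside
  (\<open>has_colength_monom_span_iff\<close>), so \<open>W\<close> is \<open>U\<close> with one point removed, and that point is an
  addable box.  Conversely, if \<open>W\<close> is \<open>U\<close> without a minimal exponent, both variables
  annihilate \<open>J/I\<close>, which forces the residual point to be the origin
  (\<open>residual_point_remove_min_exponent\<close>), and \<open>(I, J)\<close> does lie in the fibre.
\<close>

section \<open>Ideals of the polynomial ring\<close>

\<comment> \<open>Exponents are treated as elements of the monoid \<open>\<nat>\<^sup>2\<close>; their coordinates stay hidden.\<close>
declare split_paired_All [simp del] split_paired_Ex [simp del]

lemma ring_Rxy: "ring Rxy"
  by (rule class_ring.ring_axioms)

lemma ideal_Rxy_iff: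
  "ideal I Rxy \<longleftrightarrow> 0 \<in> I \<and> (\<forall>f\<in>I. \<forall>g\<in>I. f + g \<in> I) \<and> (\<forall>r. \<forall>f\<in>I. r * f \<in> I)"
    (is "_ \<longleftrightarrow> ?closed")
proof
  assume "ideal I Rxy"
  then interpret ideal I Rxy .
  show ?closed
    using zero_closed a_closed I_l_closed by simp
next
  assume closed: ?closed
  show "ideal I Rxy"
  proof (rule idealI)
    show "ring Rxy" by (rule ring_Rxy)
    show "subgroup I (add_monoid Rxy)"
    proof (rule group.subgroupI)
      show "group (add_monoid Rxy)"
        by (rule abelian_group.a_group[OF ring.is_abelian_group[OF ring_Rxy]])
      fix f assume f: "f \<in> I"
      have "(- 1) * f \<in> I" using closed f by blast
      then have "- f \<in> I" by simp
      moreover have "inv\<^bsub>add_monoid Rxy\<^esub> f = - f"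
        unfolding a_inv_def[symmetric] by (simp only: class_ring_simps)
      ultimately show "inv\<^bsub>add_monoid Rxy\<^esub> f \<in> I" by simp
    qed (use closed in auto)
    fix r f assume f: "f \<in> I"
    have "r * f \<in> I" using closed f by blast
    then show "r \<otimes>\<^bsub>Rxy\<^esub> f \<in> I" "f \<otimes>\<^bsub>Rxy\<^esub> r \<in> I"
      by (simp_all add: mult.commute)
  qed
qed

lemma ideal_zero: "ideal I Rxy \<Longrightarrow> 0 \<in> I"
  and ideal_add: "ideal I Rxy \<Longrightarrow> f \<in> I \<Longrightarrow> g \<in> I \<Longrightarrow> f + g \<in> I"
  and ideal_mult: "ideal I Rxy \<Longrightarrow> f \<in> I \<Longrightarrow> r * f \<in> I"
  by (auto simp: ideal_Rxy_iff)

lemma ideal_uminus: "ideal I Rxy \<Longrightarrow> f \<in> I \<Longrightarrow> - f \<in> I"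
  using ideal_mult[of I f "- 1"] by simp

lemma ideal_diff: "ideal I Rxy \<Longrightarrow> f \<in> I \<Longrightarrow> g \<in> I \<Longrightarrow> f - g \<in> I"
  using ideal_add[of I f "- g"] ideal_uminus[of I g] by simp

lemma ideal_sum: "ideal I Rxy \<Longrightarrow> (\<And>b. b \<in> B \<Longrightarrow> f b \<in> I) \<Longrightarrow> sum f B \<in> I"
  by (induction B rule: infinite_finite_induct) (auto simp: ideal_zero ideal_add)

lemma ideal_UNIV: "ideal UNIV Rxy"
  by (simp add: ideal_Rxy_iff)


section \<open>Ideals spanned by monomials\<close>

definition monom_span :: "(nat \<times> nat) set \<Rightarrow> poly_xy set" where
  "monom_span U = {f. Poly_Mapping.keys f \<subseteq> U}"

definition up_closed :: "(nat \<times> nat) set \<Rightarrow> bool" where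
  "up_closed U \<longleftrightarrow> (\<forall>u\<in>U. \<forall>c. u + c \<in> U)"

definition upward :: "(nat \<times> nat) set \<Rightarrow> (nat \<times> nat) set" where
  "upward B = {b + c |b c. b \<in> B}"

definition min_exponents :: "(nat \<times> nat) set \<Rightarrow> (nat \<times> nat) set" where
  "min_exponents U = {u \<in> U. \<forall>v c. v \<in> U \<longrightarrow> u = v + c \<longrightarrow> c = 0}"

lemma xy_monom_in_monom_span [simp]: "xy_monom b \<in> monom_span U \<longleftrightarrow> b \<in> U"
  by (simp add: monom_span_def xy_monom_def)

lemma monom_span_mono: "U \<subseteq> V \<Longrightarrow> monom_span U \<subseteq> monom_span V"
  by (auto simp: monom_span_def)

lemma monom_span_UNIV [simp]: "monom_span UNIV = UNIV"
  by (simp add: monom_span_def)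

lemma monom_span_inject [simp]: "monom_span U = monom_span V \<longleftrightarrow> U = V"
  using xy_monom_in_monom_span by blast

lemma inj_xy_monom: "inj xy_monom"
  by (rule injI) (metis xy_monom_in_monom_span singletonD singletonI)

lemma const_xy_mult_monom: "const_xy c * xy_monom b = Poly_Mapping.single b c"
  by (simp add: const_xy_def xy_monom_def mult_single flip: zero_prod_def)

lemma lookup_const_xy_mult: "Poly_Mapping.lookup (const_xy c * f) b = c * Poly_Mapping.lookup f b"
  by (simp add: const_xy_def mult_map_scale_conv_mult[symmetric] zero_prod_def[symmetric]
      Poly_Mapping.map.rep_eq when_def)

lemma monomial_expansion:
  assumes "finite B" "Poly_Mapping.keys f \<subseteq> B"
  shows "f = (\<Sum>b\<in>B. const_xy (Poly_Mapping.lookup f b) * xy_monom b)"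
proof (rule poly_mapping_eqI)
  fix k
  have "(\<Sum>b\<in>B. Poly_Mapping.lookup (Poly_Mapping.single b (Poly_Mapping.lookup f b)) k)
      = (\<Sum>b\<in>B. if b = k then Poly_Mapping.lookup f k else 0)"
    by (rule sum.cong) (auto simp: lookup_single when_def)
  also have "\<dots> = Poly_Mapping.lookup f k"
    using assms by (auto simp: not_in_keys_iff_lookup_eq_zero[symmetric])
  finally show "Poly_Mapping.lookup f k =
      Poly_Mapping.lookup (\<Sum>b\<in>B. const_xy (Poly_Mapping.lookup f b) * xy_monom b) k"
    by (simp add: lookup_sum const_xy_mult_monom)
qed

text \<open>
  Ideals are closed under complex scalars, since constants are polynomials; containing the monomials
  is thus enough to contain their linear span.
\<close>

lemma ideal_contains_monom_span:
  assumes "ideal I Rxy" "xy_monom ` B \<subseteq> I"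
  shows "monom_span B \<subseteq> I"
proof
  fix f assume "f \<in> monom_span B"
  then have "(\<Sum>b\<in>Poly_Mapping.keys f. const_xy (Poly_Mapping.lookup f b) * xy_monom b) \<in> I"
    using assms by (intro ideal_sum ideal_mult) (auto simp: monom_span_def)
  then show "f \<in> I"
    using monomial_expansion[OF finite_keys order_refl, of f] by simp
qed

lemma ideal_monom_span:
  assumes "up_closed U"
  shows "ideal (monom_span U) Rxy"
  unfolding ideal_Rxy_iff
proof (intro conjI ballI allI)
  show "0 \<in> monom_span U" by (simp add: monom_span_def)
next
  fix f g assume "f \<in> monom_span U" "g \<in> monom_span U"
  then show "f + g \<in> monom_span U"
    using Poly_Mapping.keys_add[of f g] by (auto simp: monom_span_def)
next
  fix r f assume f: "f \<in> monom_span U"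
  show "r * f \<in> monom_span U"
    unfolding monom_span_def
  proof safe
    fix i j assume "(i, j) \<in> Poly_Mapping.keys (r * f)"
    then obtain a b where "(i, j) = a + b" "b \<in> Poly_Mapping.keys f"
      using keys_mult[of r f] by blast
    moreover have "b \<in> U"
      using f calculation(2) by (auto simp: monom_span_def)
    ultimately show "(i, j) \<in> U"
      using assms by (metis up_closed_def add.commute)
  qed
qed

lemma up_closedD: "up_closed U \<Longrightarrow> u \<in> U \<Longrightarrow> u + c \<in> U"
  by (simp add: up_closed_def)

lemma upwardI: "b \<in> B \<Longrightarrow> b + c \<in> upward B"
  unfolding upward_def by blast

lemma upward_self: "b \<in> B \<Longrightarrow> b \<in> upward B"
  using upwardI[of b B 0] by simp

lemma upwardE:
  assumes "u \<in> upward B"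
  obtains b c where "b \<in> B" "u = b + c"
  using assms unfolding upward_def by blast

lemma up_closed_upward: "up_closed (upward B)"
  unfolding up_closed_def
proof (intro ballI allI)
  fix u c assume "u \<in> upward B"
  then obtain b d where b: "b \<in> B" "u = b + d" by (rule upwardE)
  show "u + c \<in> upward B"
    using upwardI[OF b(1), of "d + c"] by (simp only: b(2) add.assoc)
qed

lemma upward_subset: "up_closed U \<Longrightarrow> B \<subseteq> U \<Longrightarrow> upward B \<subseteq> U"
  by (blast elim: upwardE intro: up_closedD)

lemma upward_up_closed: "up_closed U \<Longrightarrow> upward U = U"
  using upward_subset[of U U] upward_self by blast

lemma min_exponents_subset: "min_exponents U \<subseteq> U"
  by (auto simp: min_exponents_def)

lemma genideal_monomials: "genideal Rxy (xy_monom ` B) = monom_span (upward B)"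
proof
  have "xy_monom ` B \<subseteq> monom_span (upward B)"
    by (auto intro: upward_self)
  then show "genideal Rxy (xy_monom ` B) \<subseteq> monom_span (upward B)"
    by (rule ring.genideal_minimal[OF ring_Rxy ideal_monom_span[OF up_closed_upward]])
next
  have I: "ideal (genideal Rxy (xy_monom ` B)) Rxy"
    by (rule ring.genideal_ideal[OF ring_Rxy]) simp
  have gen: "xy_monom ` B \<subseteq> genideal Rxy (xy_monom ` B)"
    by (rule ring.genideal_self[OF ring_Rxy]) simp
  show "monom_span (upward B) \<subseteq> genideal Rxy (xy_monom ` B)"
  proof (rule ideal_contains_monom_span[OF I], clarify)
    fix i j assume "(i, j) \<in> upward B"
    then obtain b c where b: "b \<in> B" "(i, j) = b + c"
      by (rule upwardE)
    have "xy_monom c * xy_monom b \<in> genideal Rxy (xy_monom ` B)"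
      using ideal_mult[OF I] gen b(1) by blast
    then show "xy_monom (i, j) \<in> genideal Rxy (xy_monom ` B)"
      by (simp add: b(2) xy_monom_def mult_single add.commute)
  qed
qed

lemma ideal_outside_eq_monom_span: "up_closed (- D) \<Longrightarrow> ideal_outside D = monom_span (- D)"
  by (simp add: ideal_outside_def genideal_monomials upward_up_closed)

text \<open>
  The order on exponents is well-founded: descending from an exponent lowers the sum of its
  coordinates, so every exponent of \<open>U\<close> lies above a minimal one.
\<close>

lemma upward_min_exponents:
  assumes "up_closed U"
  shows "upward (min_exponents U) = U"
proof
  show "upward (min_exponents U) \<subseteq> U"
    using assms min_exponents_subset by (rule upward_subset)
next
  have "u \<in> U \<Longrightarrow> u \<in> upward (min_exponents U)" for u
  proof (induction "fst u + snd u" arbitrary: u rule: less_induct)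
    case less
    show ?case
    proof (cases "u \<in> min_exponents U")
      case True
      then show ?thesis by (rule upward_self)
    next
      case False
      then obtain v c where v: "v \<in> U" "u = v + c" "c \<noteq> 0"
        using less.prems by (auto simp: min_exponents_def)
      then have "fst v + snd v < fst u + snd u"
        by (auto simp: prod_eq_iff)
      then have "v \<in> upward (min_exponents U)"
        using less.hyps v(1) by blast
      then show ?thesis
        using up_closedD[OF up_closed_upward] v(2) by simp
    qed
  qed
  then show "U \<subseteq> upward (min_exponents U)" by blast
qed

text \<open>
  A minimal exponent is a multiple only of itself, so every monomial generating set contains all
  monomials with minimal exponent; these already generate.
\<close>

lemma min_monomial_gens_monom_span:
  assumes U: "up_closed U"
  shows "min_monomial_gens (monom_span U) = xy_monom ` min_exponents U"
proof -
  have needed: "min_exponents U \<subseteq> B" if B: "genideal Rxy (xy_monom ` B) = monom_span U" for B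
  proof
    fix a assume a: "a \<in> min_exponents U"
    have "upward B = U" using B by (simp add: genideal_monomials)
    then obtain b c where "b \<in> B" "a = b + c"
      using a min_exponents_subset upwardE by blast
    moreover have "b \<in> U"
      using \<open>b \<in> B\<close> \<open>upward B = U\<close> upward_self by blast
    ultimately show "a \<in> B"
      using a by (auto simp: min_exponents_def)
  qed
  have gen: "genideal Rxy (xy_monom ` min_exponents U) = monom_span U"
    by (simp add: genideal_monomials upward_min_exponents[OF U])
  show ?thesis
    unfolding min_monomial_gens_def
  proof (rule the_equality)
    show "is_min_monomial_gens (monom_span U) (xy_monom ` min_exponents U)"
      unfolding is_min_monomial_gens_def
    proof (intro conjI allI impI)
      fix H assume H: "H \<subset> xy_monom ` min_exponents U"
      then have "H \<subseteq> xy_monom ` min_exponents U" by (rule psubset_imp_subset)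
      then obtain B where B: "H = xy_monom ` B" "B \<subseteq> min_exponents U"
        by (rule subset_imageE)
      with H have "\<not> min_exponents U \<subseteq> B" by blast
      then show "genideal Rxy H \<noteq> monom_span U"
        using needed[of B] B(1) by blast
    qed (use gen in auto)
  next
    fix G assume G: "is_min_monomial_gens (monom_span U) G"
    then have "G \<subseteq> range xy_monom" by (simp add: is_min_monomial_gens_def)
    then obtain B where B: "G = xy_monom ` B" by (rule subset_imageE)
    have "genideal Rxy (xy_monom ` B) = monom_span U"
      using G unfolding B is_min_monomial_gens_def by blast
    then have "xy_monom ` min_exponents U \<subseteq> G"
      unfolding B by (intro image_mono needed)
    moreover have "\<not> xy_monom ` min_exponents U \<subset> G"
      using G gen unfolding is_min_monomial_gens_def by blast
    ultimately show "G = xy_monom ` min_exponents U"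
      by blast
  qed
qed

lemma up_closed_non_min:
  assumes U: "up_closed U"
  shows "up_closed (U - min_exponents U)"
  unfolding up_closed_def
proof (intro ballI allI)
  fix u c assume "u \<in> U - min_exponents U"
  then obtain v d where v: "v \<in> U" "u = v + d" "d \<noteq> 0"
    by (auto simp: min_exponents_def)
  then have "u + c = v + (d + c)" "d + c \<noteq> 0"
    by (auto simp: add.assoc prod_eq_iff)
  then show "u + c \<in> U - min_exponents U"
    using v(1) up_closedD[OF U, of v "d + c"] by (auto simp: min_exponents_def)
qed

text \<open>
  A product with a polynomial without constant term only involves exponents properly above some
  exponent of \<open>U\<close>.  The same fact describes \<open>(x,y)J\<close> and shows that the variables annihilate
  \<open>J/I\<close> in the fibre.
\<close>

lemma mult_monom_span_min:
  assumes U: "up_closed U" and g: "g \<in> monom_span (- {0})" and h: "h \<in> monom_span U"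
  shows "g * h \<in> monom_span (U - min_exponents U)"
proof -
  have "u \<in> U - min_exponents U" if u: "u \<in> Poly_Mapping.keys (g * h)" for u
  proof -
    obtain a b where ab: "u = a + b" "a \<in> Poly_Mapping.keys g" "b \<in> Poly_Mapping.keys h"
      using u keys_mult[of g h] by blast
    then have "a \<noteq> 0" "b \<in> U"
      using g h by (auto simp: monom_span_def)
    then show ?thesis
      using U ab(1) by (auto simp: up_closed_def min_exponents_def add.commute)
  qed
  then show ?thesis by (auto simp: monom_span_def)
qed

lemma m_times_monom_span:
  assumes U: "up_closed U"
  shows "m_times (monom_span U) = monom_span (U - min_exponents U)"
proof -
  have up: "upward {(1, 0), (0, 1)} = - {(0, 0)}"
  proof (intro equalityI subsetI)
    fix u assume u: "u \<in> - {(0, 0) :: nat \<times> nat}"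
    have "u = (1, 0) + (fst u - 1, snd u)" if "fst u \<noteq> 0"
      using that by (simp add: prod_eq_iff)
    moreover have "u = (0, 1) + (fst u, snd u - 1)" if "fst u = 0"
      using that u by (cases u) simp
    ultimately show "u \<in> upward {(1, 0), (0, 1)}"
      unfolding upward_def by blast
  qed (auto simp: upward_def)
  have m: "genideal Rxy {var_x, var_y} = monom_span (- {(0, 0)})"
    using genideal_monomials[of "{(1, 0), (0, 1)}"] up by simp
  have ideal_m: "ideal (monom_span (- {(0, 0)})) Rxy"
    using up up_closed_upward ideal_monom_span by metis
  have prod: "ideal (m_times (monom_span U)) Rxy"
    unfolding m_times_def m
    by (rule ring.ideal_prod_is_ideal[OF ring_Rxy ideal_m ideal_monom_span[OF U]])
  show ?thesis
  proof
    show "m_times (monom_span U) \<subseteq> monom_span (U - min_exponents U)"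
    proof
      fix f assume "f \<in> m_times (monom_span U)"
      then show "f \<in> monom_span (U - min_exponents U)"
        unfolding m_times_def m
      proof (induction rule: ideal_prod.induct)
        case (prod g h)
        then show ?case
          using mult_monom_span_min[OF U] by (simp add: zero_prod_def)
      next
        case (sum f g)
        then show ?case
          using Poly_Mapping.keys_add[of f g] by (auto simp: monom_span_def)
      qed
    qed
  next
    show "monom_span (U - min_exponents U) \<subseteq> m_times (monom_span U)"
    proof (rule ideal_contains_monom_span[OF prod], rule image_subsetI)
      fix u assume "u \<in> U - min_exponents U"
      then obtain v c where v: "v \<in> U" "u = v + c" "c \<noteq> 0"
        by (auto simp: min_exponents_def)
      have "xy_monom c \<otimes>\<^bsub>Rxy\<^esub> xy_monom v \<in> m_times (monom_span U)"
        unfolding m_times_def m using v by (intro ideal_prod.prod) (auto simp: zero_prod_def)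
      then show "xy_monom u \<in> m_times (monom_span U)"
        by (simp add: v(2) xy_monom_def mult_single add.commute)
    qed
  qed
qed


section \<open>Quotients of ideals\<close>

lemma coset_eq_iff:
  assumes N: "ideal N Rxy"
  shows "N +>\<^bsub>Rxy\<^esub> f = N +>\<^bsub>Rxy\<^esub> g \<longleftrightarrow> f - g \<in> N"
proof
  assume eq: "N +>\<^bsub>Rxy\<^esub> f = N +>\<^bsub>Rxy\<^esub> g"
  have "f \<in> N +>\<^bsub>Rxy\<^esub> f"
    using ideal_zero[OF N] by (force simp: a_r_coset_def')
  then obtain h where "h \<in> N" "f = h + g"
    unfolding eq by (auto simp: a_r_coset_def')
  then show "f - g \<in> N" by simp
next
  assume d: "f - g \<in> N"
  have "\<exists>h'\<in>N. h + f = h' + g" "\<exists>h'\<in>N. h + g = h' + f" if "h \<in> N" for h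
    using ideal_add[OF N that d] ideal_diff[OF N that d]
    by (force simp: algebra_simps)+
  then show "N +>\<^bsub>Rxy\<^esub> f = N +>\<^bsub>Rxy\<^esub> g"
    by (fastforce simp: a_r_coset_def')
qed

lemma coset_zero: "ideal N Rxy \<Longrightarrow> N +>\<^bsub>Rxy\<^esub> 0 = N"
  by (auto simp: a_r_coset_def')

lemma coset_eq_ideal_iff: "ideal N Rxy \<Longrightarrow> N +>\<^bsub>Rxy\<^esub> f = N \<longleftrightarrow> f \<in> N"
  using coset_eq_iff[of N f 0] by (simp add: coset_zero)

lemma mem_coset_iff: "f \<in> N +>\<^bsub>Rxy\<^esub> g \<longleftrightarrow> f - g \<in> N"
  by (force simp: a_r_coset_def' algebra_simps)

lemma carrier_quot_mod [simp]: "carrier (quot_mod sc M N) = (\<lambda>f. N +>\<^bsub>Rxy\<^esub> f) ` M"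
  and zero_quot_mod [simp]: "\<zero>\<^bsub>quot_mod sc M N\<^esub> = N"
  by (simp_all add: quot_mod_def)

lemma add_quot_mod:
  assumes N: "ideal N Rxy"
  shows "(N +>\<^bsub>Rxy\<^esub> f) \<oplus>\<^bsub>quot_mod sc M N\<^esub> (N +>\<^bsub>Rxy\<^esub> g) = N +>\<^bsub>Rxy\<^esub> (f + g)"
proof -
  have "h - (f + g) \<in> N \<longleftrightarrow> (\<exists>a b. h = a + b \<and> a - f \<in> N \<and> b - g \<in> N)" for h
  proof
    assume "h - (f + g) \<in> N"
    then have "h = (h - g) + g \<and> (h - g) - f \<in> N \<and> g - g \<in> N"
      using ideal_zero[OF N] by (simp add: algebra_simps)
    then show "\<exists>a b. h = a + b \<and> a - f \<in> N \<and> b - g \<in> N" by blast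
  next
    assume "\<exists>a b. h = a + b \<and> a - f \<in> N \<and> b - g \<in> N"
    then obtain a b where "h = a + b" "a - f \<in> N" "b - g \<in> N" by blast
    then show "h - (f + g) \<in> N"
      using ideal_add[OF N, of "a - f" "b - g"] by (simp add: algebra_simps)
  qed
  moreover have "h \<in> (N +>\<^bsub>Rxy\<^esub> f) \<oplus>\<^bsub>quot_mod sc M N\<^esub> (N +>\<^bsub>Rxy\<^esub> g) \<longleftrightarrow>
      (\<exists>a b. h = a + b \<and> a - f \<in> N \<and> b - g \<in> N)" for h
    by (simp add: quot_mod_def set_add_def' Bex_def mem_coset_iff) blast
  ultimately show ?thesis
    unfolding set_eq_iff by (simp only: mem_coset_iff simp_thms)
qed

text \<open>
  Scalar multiplication of cosets is a union over representatives; it collapses to one coset as soon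
  as the action respects congruence modulo \<open>N\<close>.
\<close>

lemma smult_quot_mod:
  assumes N: "ideal N Rxy" and diff: "\<And>f g. f - g \<in> N \<Longrightarrow> sc c f - sc c g \<in> N"
  shows "c \<odot>\<^bsub>quot_mod sc M N\<^esub> (N +>\<^bsub>Rxy\<^esub> f) = N +>\<^bsub>Rxy\<^esub> sc c f"
proof -
  have "N +>\<^bsub>Rxy\<^esub> sc c g = N +>\<^bsub>Rxy\<^esub> sc c f" if "g \<in> N +>\<^bsub>Rxy\<^esub> f" for g
    using that by (simp add: coset_eq_iff[OF N] mem_coset_iff diff)
  moreover have "f \<in> N +>\<^bsub>Rxy\<^esub> f"
    by (simp add: mem_coset_iff ideal_zero[OF N])
  then have "N +>\<^bsub>Rxy\<^esub> f \<noteq> {}" by blast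
  ultimately have "(\<Union>g\<in>N +>\<^bsub>Rxy\<^esub> f. N +>\<^bsub>Rxy\<^esub> sc c g) = N +>\<^bsub>Rxy\<^esub> sc c f"
    by (intro SUP_eq_const)
  then show ?thesis
    by (simp only: quot_mod_def module.simps)
qed

lemma smult_quot_Rmod:
  assumes N: "ideal N Rxy"
  shows "r \<odot>\<^bsub>quot_Rmod M N\<^esub> (N +>\<^bsub>Rxy\<^esub> f) = N +>\<^bsub>Rxy\<^esub> (r * f)"
  by (rule smult_quot_mod[OF N]) (simp add: ideal_mult[OF N] flip: right_diff_distrib)

lemma smult_quot_space:
  assumes N: "ideal N Rxy"
  shows "c \<odot>\<^bsub>quot_space M N\<^esub> (N +>\<^bsub>Rxy\<^esub> f) = N +>\<^bsub>Rxy\<^esub> (const_xy c * f)"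
proof -
  have "c \<odot>\<^bsub>quot_space M N\<^esub> (N +>\<^bsub>Rxy\<^esub> f) = N +>\<^bsub>Rxy\<^esub> scale_xy c f"
    by (rule smult_quot_mod[OF N])
      (simp add: scale_xy_def ideal_mult[OF N] flip: right_diff_distrib)
  then show ?thesis by (simp add: scale_xy_def)
qed

lemma const_xy_one: "const_xy 1 = 1"
  and const_xy_add: "const_xy (c + d) = const_xy c + const_xy d"
  and const_xy_mult: "const_xy (c * d) = const_xy c * const_xy d"
  by (simp_all add: const_xy_def single_add mult_single zero_prod_def[symmetric])

lemma vectorspace_quot_space:
  assumes M: "ideal M Rxy" and N: "ideal N Rxy"
  shows "vectorspace class_ring (quot_space M N)"
proof (rule vs_criteria)
  show "field (class_ring :: complex ring)" by (rule class_field)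
  show "\<zero>\<^bsub>quot_space M N\<^esub> \<in> carrier (quot_space M N)"
    using ideal_zero[OF M] coset_zero[OF N] by (metis carrier_quot_mod zero_quot_mod imageI)
  show "\<forall>v\<in>carrier (quot_space M N). \<exists>w\<in>carrier (quot_space M N).
      v \<oplus>\<^bsub>quot_space M N\<^esub> w = \<zero>\<^bsub>quot_space M N\<^esub>"
  proof
    fix v assume "v \<in> carrier (quot_space M N)"
    then obtain f where "f \<in> M" "v = N +>\<^bsub>Rxy\<^esub> f" by auto
    then show "\<exists>w\<in>carrier (quot_space M N). v \<oplus>\<^bsub>quot_space M N\<^esub> w = \<zero>\<^bsub>quot_space M N\<^esub>"
      using ideal_uminus[OF M]
      by (intro bexI[of _ "N +>\<^bsub>Rxy\<^esub> (- f)"]) (auto simp: add_quot_mod[OF N] coset_zero[OF N])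
  qed
  have "(N +>\<^bsub>Rxy\<^esub> f) \<oplus>\<^bsub>quot_space M N\<^esub> N = N +>\<^bsub>Rxy\<^esub> f" for f
    using add_quot_mod[OF N, where f = f and g = 0 and M = M and sc = scale_xy] coset_zero[OF N] by simp
  then show "\<forall>v\<in>carrier (quot_space M N). v \<oplus>\<^bsub>quot_space M N\<^esub> \<zero>\<^bsub>quot_space M N\<^esub> = v"
    by auto
qed (auto simp: add_quot_mod[OF N] smult_quot_space[OF N] ideal_add[OF M] ideal_mult[OF M]
      const_xy_one const_xy_add const_xy_mult ring_distribs add.assoc add.commute add.left_commute mult.assoc)

text \<open>
  A linear combination of cosets of monomials is the coset of the polynomial with these
  coefficients.  This turns span and independence in the quotient into statements about exponents.
\<close>

lemma lincomb_monomial_cosets: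
  assumes U: "up_closed U" and V: "up_closed V"
    and B: "finite B" "B \<subseteq> U - V"
  shows "module.lincomb (quot_space (monom_span U) (monom_span V)) c
      ((\<lambda>b. monom_span V +>\<^bsub>Rxy\<^esub> xy_monom b) ` B) =
    monom_span V +>\<^bsub>Rxy\<^esub> (\<Sum>b\<in>B. const_xy (c (monom_span V +>\<^bsub>Rxy\<^esub> xy_monom b)) * xy_monom b)"
  using B
proof (induction B rule: finite_induct)
  case empty
  interpret vectorspace class_ring "quot_space (monom_span U) (monom_span V)"
    by (rule vectorspace_quot_space) (simp_all add: ideal_monom_span U V)
  show ?case
    by (simp add: lincomb_def coset_zero ideal_monom_span V)
next
  case (insert a B)
  interpret vectorspace class_ring "quot_space (monom_span U) (monom_span V)"
    by (rule vectorspace_quot_space) (simp_all add: ideal_monom_span U V)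
  have VI: "ideal (monom_span V) Rxy" by (simp add: ideal_monom_span V)
  let ?p = "\<lambda>b. monom_span V +>\<^bsub>Rxy\<^esub> xy_monom b"
  have new: "?p a \<notin> ?p ` B"
  proof
    assume "?p a \<in> ?p ` B"
    then obtain b where b: "b \<in> B" "?p a = ?p b" by blast
    then have "xy_monom a - xy_monom b \<in> monom_span V"
      using coset_eq_iff[OF VI] by blast
    moreover have "a \<in> Poly_Mapping.keys (xy_monom a - xy_monom b)"
      using b insert.hyps by (auto simp: in_keys_iff xy_monom_def lookup_minus lookup_single when_def)
    ultimately show False
      using insert.prems by (auto simp: monom_span_def)
  qed
  have carr: "?p ` insert a B \<subseteq> carrier (quot_space (monom_span U) (monom_span V))"
    using insert.prems by auto
  have "lincomb c (?p ` B \<union> {?p a}) =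
      c (?p a) \<odot>\<^bsub>quot_space (monom_span U) (monom_span V)\<^esub> ?p a
      \<oplus>\<^bsub>quot_space (monom_span U) (monom_span V)\<^esub> lincomb c (?p ` B)"
    by (rule lincomb_insert) (use insert.hyps carr new in auto)
  then show ?case
    using insert by (simp add: smult_quot_space[OF VI] add_quot_mod[OF VI])
qed

lemma inj_on_monomial_cosets:
  assumes V: "up_closed V"
  shows "inj_on (\<lambda>b. monom_span V +>\<^bsub>Rxy\<^esub> xy_monom b) (- V)"
proof (rule inj_onI, rule ccontr)
  fix a b assume ab: "a \<in> - V" "a \<noteq> b"
    and eq: "monom_span V +>\<^bsub>Rxy\<^esub> xy_monom a = monom_span V +>\<^bsub>Rxy\<^esub> xy_monom b"
  have "xy_monom a - xy_monom b \<in> monom_span V"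
    using eq coset_eq_iff[OF ideal_monom_span[OF V]] by blast
  moreover have "a \<in> Poly_Mapping.keys (xy_monom a - xy_monom b)"
    using ab by (auto simp: in_keys_iff xy_monom_def lookup_minus lookup_single when_def)
  ultimately show False
    using ab by (auto simp: monom_span_def)
qed

lemma lookup_sum_monomials:
  "finite B \<Longrightarrow> Poly_Mapping.lookup (\<Sum>b\<in>B. const_xy (c b) * xy_monom b) a =
    (if a \<in> B then c a else 0)"
proof -
  assume "finite B"
  moreover have "(\<Sum>b\<in>B. Poly_Mapping.lookup (Poly_Mapping.single b (c b)) a)
      = (\<Sum>b\<in>B. if b = a then c a else 0)"
    by (rule sum.cong) (auto simp: lookup_single when_def)
  ultimately show ?thesis
    by (simp add: lookup_sum const_xy_mult_monom)
qed

lemma basis_monomial_cosets: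
  assumes U: "up_closed U" and V: "up_closed V"
  shows "vectorspace.basis class_ring (quot_space (monom_span U) (monom_span V))
    ((\<lambda>b. monom_span V +>\<^bsub>Rxy\<^esub> xy_monom b) ` (U - V))"
proof -
  let ?Q = "quot_space (monom_span U) (monom_span V)"
  let ?p = "\<lambda>b. monom_span V +>\<^bsub>Rxy\<^esub> xy_monom b"
  interpret vectorspace class_ring ?Q
    by (rule vectorspace_quot_space) (simp_all add: ideal_monom_span U V)
  have VI: "ideal (monom_span V) Rxy" by (simp add: ideal_monom_span V)
  have inj: "inj_on ?p (U - V)"
    using inj_on_monomial_cosets[OF V] by (rule inj_on_subset) auto
  have carr: "?p ` (U - V) \<subseteq> carrier ?Q" by auto
  have "lin_indpt (?p ` (U - V))"
  proof
    assume "lin_dep (?p ` (U - V))"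
    then obtain A c v where A: "finite A" "A \<subseteq> ?p ` (U - V)" "lincomb c A = \<zero>\<^bsub>?Q\<^esub>"
      and v: "v \<in> A" "c v \<noteq> 0"
      by (auto simp: lin_dep_def)
    obtain B where B: "finite B" "B \<subseteq> U - V" "A = ?p ` B"
      using finite_subset_image[OF A(1,2)] by blast
    obtain b where b: "b \<in> B" "v = ?p b" using v B by blast
    have "monom_span V +>\<^bsub>Rxy\<^esub> (\<Sum>b\<in>B. const_xy (c (?p b)) * xy_monom b) = monom_span V"
      using A(3) lincomb_monomial_cosets[OF U V B(1,2), of c] by (simp add: B(3))
    then have "(\<Sum>b\<in>B. const_xy (c (?p b)) * xy_monom b) \<in> monom_span V"
      by (simp add: coset_eq_ideal_iff[OF VI])
    moreover have "b \<in> Poly_Mapping.keys (\<Sum>b\<in>B. const_xy (c (?p b)) * xy_monom b)"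
      using lookup_sum_monomials[OF B(1), of "\<lambda>b. c (?p b)" b] b v by (simp add: in_keys_iff)
    ultimately show False
      using b B by (auto simp: monom_span_def)
  qed
  moreover have "carrier ?Q \<subseteq> span (?p ` (U - V))"
  proof
    fix w assume "w \<in> carrier ?Q"
    then obtain f where f: "f \<in> monom_span U" "w = monom_span V +>\<^bsub>Rxy\<^esub> f" by auto
    let ?B = "Poly_Mapping.keys f - V"
    \<comment> \<open>Coefficients in the quotient are attached to cosets, so each coset must recover its exponent.\<close>
    define c where "c v = Poly_Mapping.lookup f (the_inv_into (U - V) ?p v)" for v
    have B: "finite ?B" "?B \<subseteq> U - V" using f(1) by (auto simp: monom_span_def)
    have c: "c (?p b) = Poly_Mapping.lookup f b" if "b \<in> ?B" for b
      using that B(2) by (auto simp: c_def the_inv_into_f_f[OF inj])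
    let ?g = "\<Sum>b\<in>?B. const_xy (c (?p b)) * xy_monom b"
    have "Poly_Mapping.keys (f - ?g) \<subseteq> V"
    proof
      fix a assume "a \<in> Poly_Mapping.keys (f - ?g)"
      then show "a \<in> V"
        using lookup_sum_monomials[OF B(1), of "\<lambda>b. c (?p b)" a] c[of a]
        by (auto simp: in_keys_iff lookup_minus split: if_splits)
    qed
    then have "f - ?g \<in> monom_span V" by (simp add: monom_span_def)
    then have "w = lincomb c (?p ` ?B)"
      using lincomb_monomial_cosets[OF U V B, of c] coset_eq_iff[OF VI, of f ?g] f(2) by simp
    then show "w \<in> span (?p ` (U - V))"
      unfolding span_def using B by (auto intro!: exI[of _ c] exI[of _ "?p ` ?B"])
  qed
  ultimately show ?thesis
    unfolding basis_def using span_is_subset2[OF carr] carr by blast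
qed

text \<open>
  The monomials outside \<open>U\<close> are independent in the quotient even when there are infinitely many of
  them, so finite dimension forces their number to be finite.
\<close>

lemma has_colength_monom_span_iff:
  assumes U: "up_closed U"
  shows "has_colength (monom_span U) n \<longleftrightarrow> finite (- U) \<and> card (- U) = n"
proof -
  let ?Q = "quot_space UNIV (monom_span U)"
  let ?B = "(\<lambda>b. monom_span U +>\<^bsub>Rxy\<^esub> xy_monom b) ` (- U)"
  interpret vectorspace class_ring ?Q
    by (rule vectorspace_quot_space) (simp_all add: ideal_UNIV ideal_monom_span U)
  have basis: "basis ?B"
    using basis_monomial_cosets[OF _ U, of UNIV] by (simp add: up_closed_def Compl_eq_Diff_UNIV)
  have fin: "finite ?B \<longleftrightarrow> finite (- U)" and card: "card ?B = card (- U)"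
    using inj_on_monomial_cosets[OF U] by (auto simp: finite_image_iff card_image)
  have "fin_dim \<longleftrightarrow> finite ?B"
    using basis li_le_dim(1)[of ?B] unfolding basis_def fin_dim_def by blast
  then show ?thesis
    unfolding has_colength_def using dim_basis[OF _ basis] fin card by auto
qed


section \<open>Partitions and addable boxes\<close>

lemma up_closed_compl_young_diagram:
  assumes "is_partition \<mu>"
  shows "up_closed (- young_diagram \<mu>)"
  unfolding up_closed_def
proof (intro ballI allI)
  fix u c assume u: "u \<in> - young_diagram \<mu>"
  show "u + c \<in> - young_diagram \<mu>"
  proof
    assume "u + c \<in> young_diagram \<mu>"
    then have len: "snd u + snd c < length \<mu>" and col: "fst u + fst c < \<mu> ! (snd u + snd c)"
      by (auto simp: young_diagram_def plus_prod_def)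
    have "\<mu> ! (snd u + snd c) \<le> \<mu> ! snd u"
    proof (cases "snd c = 0")
      case False
      then show ?thesis
        using sorted_wrt_nth_less[of "(\<ge>)" \<mu> "snd u" "snd u + snd c"] assms len
        by (simp add: is_partition_def)
    qed simp
    then have "u \<in> young_diagram \<mu>"
      using len col by (cases u) (simp add: young_diagram_def)
    then show False using u by blast
  qed
qed

lemma finite_young_diagram: "finite (young_diagram \<mu>)"
proof -
  have "young_diagram \<mu> = (\<Union>j<length \<mu>. (\<lambda>i. (i, j)) ` {..<\<mu> ! j})"
    by (auto simp: young_diagram_def)
  then show ?thesis by simp
qed

lemma finite_lower_set_nat:
  fixes A :: "nat set"
  assumes "finite A" "\<And>a b. a \<in> A \<Longrightarrow> b \<le> a \<Longrightarrow> b \<in> A"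
  shows "A = {..<card A}"
proof (cases "A = {}")
  case False
  then have "A = {..Max A}"
    using assms by (auto intro: Max_ge Max_in)
  then have "A = {..<Suc (Max A)}"
    by (simp add: lessThan_Suc_atMost)
  then show ?thesis by (metis card_lessThan)
qed simp

text \<open>The row lengths of a finite order ideal of \<open>\<nat>\<^sup>2\<close> form the partition it comes from.\<close>

lemma partition_of_diagram:
  assumes fin: "finite D" and up: "up_closed (- D)"
  obtains \<nu> where "is_partition \<nu>" "young_diagram \<nu> = D"
proof -
  have lower: "(i', j') \<in> D" if "(i, j) \<in> D" "i' \<le> i" "j' \<le> j" for i j i' j'
    using up_closedD[OF up, of "(i', j')" "(i - i', j - j')"] that by auto
  define R where "R = {j. (0, j) \<in> D}"
  define C where "C j = {i. (i, j) \<in> D}" for j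
  have "finite R"
    by (rule finite_subset[OF _ finite_imageI[OF fin, of snd]]) (auto simp: R_def intro: rev_image_eqI)
  then have R: "R = {..<card R}"
    by (rule finite_lower_set_nat) (auto simp: R_def intro: lower)
  have finC: "finite (C j)" for j
    by (rule finite_subset[OF _ finite_imageI[OF fin, of fst]]) (auto simp: C_def intro: rev_image_eqI)
  have C: "C j = {..<card (C j)}" for j
    by (rule finite_lower_set_nat[OF finC]) (auto simp: C_def intro: lower)
  define \<nu> where "\<nu> = map (\<lambda>j. card (C j)) [0..<card R]"
  have "is_partition \<nu>"
    unfolding is_partition_def
  proof
    show "sorted_wrt (\<ge>) \<nu>"
      by (auto simp: \<nu>_def sorted_wrt_map sorted_wrt_iff_nth_less C_def[abs_def]
          intro!: card_mono[OF finC[unfolded C_def]] intro: lower)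
    have "0 < card (C j)" if "j < card R" for j
    proof -
      have "j \<in> R" using that R by blast
      then have "0 \<in> C j" by (simp add: R_def C_def)
      then show ?thesis using finC[of j] by (auto simp: card_gt_0_iff)
    qed
    then show "\<forall>k\<in>set \<nu>. 0 < k" by (auto simp: \<nu>_def)
  qed
  moreover have "(i, j) \<in> young_diagram \<nu> \<longleftrightarrow> (i, j) \<in> D" for i j
  proof -
    have "(i, j) \<in> young_diagram \<nu> \<longleftrightarrow> j \<in> {..<card R} \<and> i \<in> {..<card (C j)}"
      by (auto simp: young_diagram_def \<nu>_def)
    also have "\<dots> \<longleftrightarrow> j \<in> R \<and> i \<in> C j"
      using R C[of j] by blast
    also have "\<dots> \<longleftrightarrow> (i, j) \<in> D"
      using lower[of i j 0 j] by (auto simp: R_def C_def)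
    finally show ?thesis .
  qed
  then have "young_diagram \<nu> = D" by auto
  ultimately show ?thesis by (rule that)
qed

text \<open>
  Deleting a point breaks upward closure only if the point is a proper multiple of a remaining one.
\<close>

lemma up_closed_remove_iff:
  assumes U: "up_closed U" and a: "a \<in> U"
  shows "up_closed (U - {a}) \<longleftrightarrow> a \<in> min_exponents U"
proof
  assume up: "up_closed (U - {a})"
  have "c = 0" if v: "v \<in> U" "a = v + c" for v c
  proof (rule ccontr)
    assume "c \<noteq> 0"
    then have "v \<in> U - {a}" using v by simp
    then have "v + c \<in> U - {a}" by (rule up_closedD[OF up])
    then show False using v by simp
  qed
  then show "a \<in> min_exponents U"
    using a unfolding min_exponents_def by blast
next
  assume "a \<in> min_exponents U"
  then show "up_closed (U - {a})"
    using up_closedD[OF U] unfolding up_closed_def min_exponents_def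
    by (metis (mono_tags, lifting) DiffD1 DiffD2 DiffI add.right_neutral mem_Collect_eq
        singletonD singletonI)
qed

lemma addable_boxes_eq_min_exponents:
  assumes "is_partition \<mu>"
  shows "addable_boxes \<mu> = min_exponents (- young_diagram \<mu>)"
proof -
  let ?D = "young_diagram \<mu>"
  have up: "up_closed (- ?D)"
    using assms by (rule up_closed_compl_young_diagram)
  have compl: "- insert a ?D = - ?D - {a}" for a by blast
  have "(\<exists>\<nu>. is_partition \<nu> \<and> young_diagram \<nu> = insert a ?D) \<longleftrightarrow> up_closed (- insert a ?D)" for a
  proof
    assume "\<exists>\<nu>. is_partition \<nu> \<and> young_diagram \<nu> = insert a ?D"
    then show "up_closed (- insert a ?D)"
      using up_closed_compl_young_diagram by metis
  next
    assume "up_closed (- insert a ?D)"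
    then show "\<exists>\<nu>. is_partition \<nu> \<and> young_diagram \<nu> = insert a ?D"
      using partition_of_diagram[of "insert a ?D"] finite_young_diagram by (metis finite_insert)
  qed
  then have "a \<in> addable_boxes \<mu> \<longleftrightarrow> a \<in> - ?D \<and> up_closed (- ?D - {a})" for a
    unfolding addable_boxes_def compl by blast
  then show ?thesis
    using up_closed_remove_iff[OF up] min_exponents_subset by blast
qed


section \<open>Torus-stable ideals\<close>

lemma power_const_var_x: "(const_xy c * var_x) ^ i = Poly_Mapping.single (i, 0) (c ^ i)"
  by (induction i) (simp_all add: const_xy_mult_monom mult_single flip: single_one zero_prod_def)

lemma power_const_var_y: "(const_xy c * var_y) ^ j = Poly_Mapping.single (0, j) (c ^ j)"
  by (induction j) (simp_all add: const_xy_mult_monom mult_single flip: single_one zero_prod_def)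

lemma lookup_torus_act:
  "Poly_Mapping.lookup (torus_act (q, t) f) b =
    inverse q ^ fst b * inverse t ^ snd b * Poly_Mapping.lookup f b"
proof -
  let ?c = "\<lambda>k. Poly_Mapping.lookup f k * inverse q ^ fst k * inverse t ^ snd k"
  have "torus_act (q, t) f = (\<Sum>k\<in>Poly_Mapping.keys f. const_xy (?c k) * xy_monom k)"
    unfolding torus_act_def subst_xy_def prod.case power_const_var_x power_const_var_y
    by (rule sum.cong) (auto simp: const_xy_mult_monom, simp add: const_xy_def mult_single mult_ac)
  then show ?thesis
    using lookup_sum_monomials[of "Poly_Mapping.keys f" ?c b] by (simp add: in_keys_iff)
qed

lemma torus_act_inverse:
  assumes "q \<noteq> 0" "t \<noteq> 0"
  shows "torus_act (q, t) (torus_act (inverse q, inverse t) f) = f"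
  using assms by (intro poly_mapping_eqI) (simp add: lookup_torus_act field_simps)

lemma torus_act_monom_span:
  assumes "\<tau> \<in> torus"
  shows "torus_act \<tau> ` monom_span U = monom_span U"
proof -
  obtain q t where \<tau>: "\<tau> = (q, t)" "q \<noteq> 0" "t \<noteq> 0"
    using assms by (auto simp: torus_def)
  have sub: "torus_act (q, t) f \<in> monom_span U" if "f \<in> monom_span U" for q t f
    using that by (auto simp: monom_span_def in_keys_iff lookup_torus_act)
  have "f \<in> torus_act \<tau> ` monom_span U" if "f \<in> monom_span U" for f
    using torus_act_inverse[OF \<tau>(2,3), of f] sub[OF that, of "inverse q" "inverse t"]
    unfolding \<tau>(1) by (metis imageI)
  then show ?thesis using sub \<tau>(1) by blast
qed

text \<open>
  Two exponents \<open>a \<noteq> b\<close> of \<open>f\<close> carry distinct torus characters.  For \<open>\<tau>\<close> at which these differ,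
  subtracting from \<open>\<tau> \<cdot> f\<close> the multiple of \<open>f\<close> that cancels \<open>b\<close> keeps \<open>a\<close> and shrinks the
  support; after finitely many such steps only \<open>a\<close> is left.
\<close>

lemma torus_stable_ideal_monomials:
  assumes I: "ideal I Rxy" and stable: "\<And>\<tau>. \<tau> \<in> torus \<Longrightarrow> torus_act \<tau> ` I \<subseteq> I"
    and "f \<in> I" "a \<in> Poly_Mapping.keys f"
  shows "xy_monom a \<in> I"
  using assms(3,4)
proof (induction "card (Poly_Mapping.keys f)" arbitrary: f rule: less_induct)
  case less
  show ?case
  proof (cases "Poly_Mapping.keys f = {a}")
    case True
    then have f: "const_xy (Poly_Mapping.lookup f a) * xy_monom a = f"
      using monomial_expansion[of "{a}" f] by simp
    let ?c = "inverse (Poly_Mapping.lookup f a)"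
    have "const_xy ?c * (const_xy (Poly_Mapping.lookup f a) * xy_monom a) = xy_monom a"
      using less.prems(2)
      by (simp add: in_keys_iff const_xy_one flip: mult.assoc const_xy_mult)
    then have "const_xy ?c * f = xy_monom a" by (simp only: f)
    moreover have "const_xy ?c * f \<in> I" using less.prems(1) by (rule ideal_mult[OF I])
    ultimately show ?thesis by simp
  next
    case False
    then obtain b where b: "b \<in> Poly_Mapping.keys f" "b \<noteq> a"
      using less.prems(2) by blast
    define \<chi> where "\<chi> q t k = inverse q ^ fst k * inverse t ^ snd k"
      for q t :: complex and k :: "nat \<times> nat"
    \<comment> \<open>Since 2 is not a root of unity, \<open>(2, 1)\<close> and \<open>(1, 2)\<close> together separate all exponents.\<close>
    have "inverse (2 :: complex) ^ m \<noteq> inverse 2 ^ n" if "m \<noteq> n" for m n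
    proof
      assume "inverse (2 :: complex) ^ m = inverse 2 ^ n"
      then have "norm (inverse (2 :: complex) ^ m) = norm (inverse (2 :: complex) ^ n)" by simp
      then have "(2 :: real) ^ m = 2 ^ n" 
        by (simp only: norm_power norm_inverse norm_numeral power_inverse inverse_eq_iff_eq)
      then show False using that by simp
    qed
    then have "\<chi> 2 1 a \<noteq> \<chi> 2 1 b \<or> \<chi> 1 2 a \<noteq> \<chi> 1 2 b"
      using b(2) by (auto simp: \<chi>_def prod_eq_iff)
    moreover have "(2, 1) \<in> torus" "(1, 2) \<in> torus" by (simp_all add: torus_def)
    ultimately obtain q t where qt: "(q, t) \<in> torus" "\<chi> q t a \<noteq> \<chi> q t b"
      by blast
    define g where "g = torus_act (q, t) f - const_xy (\<chi> q t b) * f"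
    have lookup_g: "Poly_Mapping.lookup g k = (\<chi> q t k - \<chi> q t b) * Poly_Mapping.lookup f k" for k
      by (simp add: g_def lookup_minus lookup_torus_act lookup_const_xy_mult \<chi>_def left_diff_distrib)
    have "torus_act (q, t) f \<in> I" using stable[OF qt(1)] less.prems(1) by blast
    then have "g \<in> I"
      unfolding g_def by (rule ideal_diff[OF I _ ideal_mult[OF I less.prems(1)]])
    moreover have "a \<in> Poly_Mapping.keys g"
      using qt(2) less.prems(2) by (simp add: in_keys_iff lookup_g)
    moreover have "Poly_Mapping.keys g \<subset> Poly_Mapping.keys f"
      using b(1) by (auto simp: in_keys_iff lookup_g psubset_eq set_eq_iff)
    then have "card (Poly_Mapping.keys g) < card (Poly_Mapping.keys f)"
      by (rule psubset_card_mono[OF finite_keys])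
    ultimately show ?thesis using less.hyps by blast
  qed
qed

lemma torus_stable_ideal_eq_monom_span:
  assumes I: "ideal I Rxy" and stable: "\<And>\<tau>. \<tau> \<in> torus \<Longrightarrow> torus_act \<tau> ` I \<subseteq> I"
  obtains U where "up_closed U" "I = monom_span U"
proof
  let ?U = "{a. xy_monom a \<in> I}"
  show "up_closed ?U"
    unfolding up_closed_def
  proof (intro ballI allI)
    fix u c assume "u \<in> ?U"
    then have "xy_monom c * xy_monom u \<in> I" using ideal_mult[OF I] by blast
    then show "u + c \<in> ?U" by (simp add: xy_monom_def mult_single add.commute)
  qed
  have "xy_monom ` ?U \<subseteq> I" by blast
  then show "I = monom_span ?U"
    using ideal_contains_monom_span[OF I] torus_stable_ideal_monomials[OF I stable]
    by (auto simp: monom_span_def)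
qed


section \<open>Evaluation and residual points\<close>

lemma eval_xy_eq_sum:
  assumes "finite B" "Poly_Mapping.keys f \<subseteq> B"
  shows "eval_xy f p = (\<Sum>b\<in>B. Poly_Mapping.lookup f b * fst p ^ fst b * snd p ^ snd b)"
proof -
  have "eval_xy f p =
      (\<Sum>b\<in>Poly_Mapping.keys f. Poly_Mapping.lookup f b * fst p ^ fst b * snd p ^ snd b)"
    by (simp add: eval_xy_def subst_xy_def case_prod_unfold)
  also have "\<dots> = (\<Sum>b\<in>B. Poly_Mapping.lookup f b * fst p ^ fst b * snd p ^ snd b)"
    using assms by (intro sum.mono_neutral_left) (auto simp: in_keys_iff)
  finally show ?thesis .
qed

lemma eval_xy_add: "eval_xy (f + g) p = eval_xy f p + eval_xy g p"
  using eval_xy_eq_sum[of "Poly_Mapping.keys f \<union> Poly_Mapping.keys g"] Poly_Mapping.keys_add[of f g]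
  by (simp add: lookup_add sum.distrib ring_distribs)

lemma eval_xy_zero [simp]: "eval_xy 0 p = 0"
  by (simp add: eval_xy_def subst_xy_def)

lemma eval_xy_sum: "eval_xy (sum f B) p = (\<Sum>b\<in>B. eval_xy (f b) p)"
  by (induction B rule: infinite_finite_induct) (simp_all add: eval_xy_add)

lemma eval_xy_single: "eval_xy (Poly_Mapping.single b c) p = c * fst p ^ fst b * snd p ^ snd b"
  using eval_xy_eq_sum[of "{b}" "Poly_Mapping.single b c" p] by simp

lemma eval_xy_mult: "eval_xy (f * g) p = eval_xy f p * eval_xy g p"
proof -
  let ?t = "\<lambda>h b. Poly_Mapping.single b (Poly_Mapping.lookup h b)"
  have expand: "h = (\<Sum>b\<in>Poly_Mapping.keys h. ?t h b)" for h :: poly_xy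
    using monomial_expansion[of "Poly_Mapping.keys h" h] by (simp add: const_xy_mult_monom)
  have "f * g = (\<Sum>a\<in>Poly_Mapping.keys f. ?t f a) * (\<Sum>b\<in>Poly_Mapping.keys g. ?t g b)"
    by (simp only: expand[symmetric])
  then have "f * g = (\<Sum>a\<in>Poly_Mapping.keys f. \<Sum>b\<in>Poly_Mapping.keys g. ?t f a * ?t g b)"
    by (simp only: sum_product)
  then have "eval_xy (f * g) p =
      (\<Sum>a\<in>Poly_Mapping.keys f. \<Sum>b\<in>Poly_Mapping.keys g. eval_xy (?t f a) p * eval_xy (?t g b) p)"
    by (simp add: eval_xy_sum mult_single eval_xy_single power_add mult_ac)
  also have "\<dots> = eval_xy (\<Sum>a\<in>Poly_Mapping.keys f. ?t f a) p *
      eval_xy (\<Sum>b\<in>Poly_Mapping.keys g. ?t g b) p"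
    by (simp only: eval_xy_sum sum_product)
  also have "\<dots> = eval_xy f p * eval_xy g p"
    by (simp only: expand[symmetric])
  finally show ?thesis .
qed

lemma eval_xy_origin: "eval_xy f (0, 0) = Poly_Mapping.lookup f 0"
proof -
  let ?B = "insert 0 (Poly_Mapping.keys f)"
  have "eval_xy f (0, 0) = (\<Sum>b\<in>?B. Poly_Mapping.lookup f b * 0 ^ fst b * 0 ^ snd b)"
    using eval_xy_eq_sum[of ?B f "(0, 0)", OF _ subset_insertI] by simp
  also have "\<dots> = (\<Sum>b\<in>?B. if b = 0 then Poly_Mapping.lookup f 0 else 0)"
    by (rule sum.cong) (auto simp: prod_eq_iff power_0_left, simp_all add: zero_prod_def)
  finally show ?thesis by simp
qed

lemma ideal_max_ideal: "ideal (max_ideal p) Rxy"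
  by (simp add: ideal_Rxy_iff max_ideal_def eval_xy_add eval_xy_mult)

text \<open>
  Only finitely many exponents lie outside \<open>U\<close>, so \<open>U\<close> contains a pure power of \<open>x\<close> and one of
  \<open>y\<close>; a common zero has both coordinates zero.
\<close>

lemma monom_span_zero_locus:
  assumes "finite (- U)"
  shows "zero_locus (monom_span U) \<subseteq> {(0, 0)}"
proof
  fix p assume p: "p \<in> zero_locus (monom_span U)"
  have "\<exists>m. (m, 0) \<in> U"
  proof (rule ccontr)
    assume "\<not> ?thesis"
    then have "range (\<lambda>m. (m, 0)) \<subseteq> - U" by auto
    then have "finite (range (\<lambda>m :: nat. (m, 0 :: nat)))" using assms by (rule finite_subset)
    then show False by (simp add: finite_image_iff inj_on_def)
  qed
  moreover have "\<exists>m. (0, m) \<in> U"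
  proof (rule ccontr)
    assume "\<not> ?thesis"
    then have "range (\<lambda>m. (0, m)) \<subseteq> - U" by auto
    then have "finite (range (\<lambda>m :: nat. (0 :: nat, m)))" using assms by (rule finite_subset)
    then show False by (simp add: finite_image_iff inj_on_def)
  qed
  ultimately obtain k l where "(k, 0) \<in> U" "(0, l) \<in> U" by blast
  then have "eval_xy (xy_monom (k, 0)) p = 0" "eval_xy (xy_monom (0, l)) p = 0"
    using p by (auto simp: zero_locus_def)
  then show "p \<in> {(0, 0)}"
    by (simp add: xy_monom_def eval_xy_single prod_eq_iff)
qed

text \<open>
  An isomorphism preserves annihilators, and the annihilator of \<open>R/\<mm>\<^sub>p\<close> is \<open>\<mm>\<^sub>p\<close> itself.  Applied to
  both variables, this locates \<open>p\<close>.
\<close>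

lemma iso_Rmod_annihilator:
  assumes I: "ideal I Rxy" and iso: "iso_Rmod (quot_Rmod J I) (quot_Rmod UNIV (max_ideal p))"
    and r: "\<And>f. f \<in> J \<Longrightarrow> r * f \<in> I"
  shows "eval_xy r p = 0"
proof -
  let ?m = "max_ideal p"
  have mI: "ideal ?m Rxy" by (rule ideal_max_ideal)
  obtain h where hom: "h \<in> LinearCombinations.module_hom Rxy (quot_Rmod J I) (quot_Rmod UNIV ?m)"
    and bij: "bij_betw h (carrier (quot_Rmod J I)) (carrier (quot_Rmod UNIV ?m))"
    using iso unfolding iso_Rmod_def by blast
  have "?m +>\<^bsub>Rxy\<^esub> 1 \<in> h ` carrier (quot_Rmod J I)"
    using bij_betw_imp_surj_on[OF bij] by simp
  then obtain f where f: "f \<in> J" "h (I +>\<^bsub>Rxy\<^esub> f) = ?m +>\<^bsub>Rxy\<^esub> 1" by auto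
  have scaled: "h (I +>\<^bsub>Rxy\<^esub> (s * f)) = ?m +>\<^bsub>Rxy\<^esub> s" for s
    using module_hom_smult[OF hom, of s "I +>\<^bsub>Rxy\<^esub> f"] f
    by (simp add: smult_quot_Rmod[OF I] smult_quot_Rmod[OF mI])
  have "I +>\<^bsub>Rxy\<^esub> (r * f) = I +>\<^bsub>Rxy\<^esub> (0 * f)"
    using r[OF f(1)] by (simp add: coset_eq_iff[OF I])
  then have "?m +>\<^bsub>Rxy\<^esub> r = ?m +>\<^bsub>Rxy\<^esub> 0"
    by (metis scaled)
  then show ?thesis
    by (simp add: coset_eq_iff[OF mI]) (simp add: max_ideal_def)
qed

text \<open>
  For a minimal exponent \<open>a\<close> of \<open>U\<close>, the coefficient of \<open>x\<^sup>a\<close> identifies the quotient by the span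
  without \<open>x\<^sup>a\<close> with the constants; minimality makes this coefficient of \<open>r f\<close> equal to the constant
  term of \<open>r\<close> times that of \<open>f\<close>.
\<close>

lemma iso_Rmod_remove_min_exponent:
  assumes U: "up_closed U" and a: "a \<in> min_exponents U"
  shows "iso_Rmod (quot_Rmod (monom_span U) (monom_span (U - {a})))
    (quot_Rmod UNIV (max_ideal (0, 0)))"
proof -
  let ?I = "monom_span (U - {a})"
  let ?m = "max_ideal (0, 0)"
  let ?M = "quot_Rmod (monom_span U) ?I"
  let ?N = "quot_Rmod UNIV ?m"
  have aU: "a \<in> U" using a min_exponents_subset by blast
  have I: "ideal ?I Rxy"
    using up_closed_remove_iff[OF U aU] a by (simp add: ideal_monom_span)
  have mI: "ideal ?m Rxy" by (rule ideal_max_ideal)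
  have mem_m: "g \<in> ?m \<longleftrightarrow> Poly_Mapping.lookup g 0 = 0" for g
    by (simp add: max_ideal_def eval_xy_origin)
  have lookup_const: "Poly_Mapping.lookup (const_xy c) 0 = c" for c
    by (simp add: const_xy_def zero_prod_def)
  have coeff_mult: "Poly_Mapping.lookup (r * f) a = Poly_Mapping.lookup r 0 * Poly_Mapping.lookup f a"
    if f: "f \<in> monom_span U" for r f
  proof -
    have "r - const_xy (Poly_Mapping.lookup r 0) \<in> monom_span (- {0})"
      by (auto simp: monom_span_def in_keys_iff lookup_minus lookup_const)
    then have "(r - const_xy (Poly_Mapping.lookup r 0)) * f \<in> monom_span (U - min_exponents U)"
      using f by (rule mult_monom_span_min[OF U])
    then have "Poly_Mapping.lookup ((r - const_xy (Poly_Mapping.lookup r 0)) * f) a = 0"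
      using a by (auto simp: monom_span_def simp flip: not_in_keys_iff_lookup_eq_zero)
    then show ?thesis
      by (simp add: left_diff_distrib lookup_minus lookup_const_xy_mult)
  qed
  \<comment> \<open>All representatives of a coset have the same coefficient at \<open>a\<close>, so any choice will do.\<close>
  define h where "h A = ?m +>\<^bsub>Rxy\<^esub> const_xy (Poly_Mapping.lookup (SOME f. f \<in> A) a)" for A
  have h: "h (?I +>\<^bsub>Rxy\<^esub> f) = ?m +>\<^bsub>Rxy\<^esub> const_xy (Poly_Mapping.lookup f a)" for f
  proof -
    have "(SOME g. g \<in> ?I +>\<^bsub>Rxy\<^esub> f) \<in> ?I +>\<^bsub>Rxy\<^esub> f"
      by (rule someI[where x = f]) (simp add: mem_coset_iff ideal_zero[OF I])
    then have "(SOME g. g \<in> ?I +>\<^bsub>Rxy\<^esub> f) - f \<in> ?I"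
      by (simp only: mem_coset_iff)
    then have "a \<notin> Poly_Mapping.keys ((SOME g. g \<in> ?I +>\<^bsub>Rxy\<^esub> f) - f)"
      by (auto simp: monom_span_def)
    then show ?thesis
      by (simp add: h_def in_keys_iff lookup_minus)
  qed
  have scaled: "?m +>\<^bsub>Rxy\<^esub> (r * const_xy c) =
      ?m +>\<^bsub>Rxy\<^esub> const_xy (Poly_Mapping.lookup r 0 * c)" for r c
    by (simp add: coset_eq_iff[OF mI] mem_m lookup_minus lookup_const lookup_const_xy_mult
        mult.commute[of r])
  have "h \<in> LinearCombinations.module_hom Rxy ?M ?N"
    by (auto simp: LinearCombinations.module_hom_def h add_quot_mod[OF I] add_quot_mod[OF mI]
        smult_quot_Rmod[OF I] smult_quot_Rmod[OF mI] lookup_add const_xy_add coeff_mult scaled)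
  moreover have "bij_betw h (carrier ?M) (carrier ?N)"
  proof (rule bij_betw_imageI)
    show "inj_on h (carrier ?M)"
    proof (rule inj_onI)
      fix A B assume "A \<in> carrier ?M" "B \<in> carrier ?M" and eq: "h A = h B"
      then obtain f g where fg: "f \<in> monom_span U" "g \<in> monom_span U"
        "A = ?I +>\<^bsub>Rxy\<^esub> f" "B = ?I +>\<^bsub>Rxy\<^esub> g" by auto
      have "Poly_Mapping.lookup f a = Poly_Mapping.lookup g a"
        using eq by (simp add: fg h coset_eq_iff[OF mI] mem_m lookup_minus lookup_const)
      then have "f - g \<in> ?I"
        using ideal_diff[OF ideal_monom_span[OF U] fg(1,2)]
        by (auto simp: monom_span_def in_keys_iff lookup_minus)
      then show "A = B" by (simp add: fg coset_eq_iff[OF I])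
    qed
    show "h ` carrier ?M = carrier ?N"
    proof
      show "h ` carrier ?M \<subseteq> carrier ?N" by (auto simp: h)
      show "carrier ?N \<subseteq> h ` carrier ?M"
      proof
        fix A assume "A \<in> carrier ?N"
        then obtain g where g: "A = ?m +>\<^bsub>Rxy\<^esub> g" by auto
        let ?f = "const_xy (Poly_Mapping.lookup g 0) * xy_monom a"
        have "Poly_Mapping.lookup ?f a = Poly_Mapping.lookup g 0"
          by (simp add: const_xy_mult_monom)
        then have "h (?I +>\<^bsub>Rxy\<^esub> ?f) = A"
          by (simp add: h g coset_eq_iff[OF mI] mem_m lookup_minus lookup_const)
        moreover have "?f \<in> monom_span U"
          using aU by (simp add: ideal_mult[OF ideal_monom_span[OF U]])
        then have "?I +>\<^bsub>Rxy\<^esub> ?f \<in> carrier ?M" by simp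
        ultimately show "A \<in> h ` carrier ?M" by blast
      qed
    qed
  qed
  ultimately show ?thesis unfolding iso_Rmod_def by blast
qed

lemma residual_point_remove_min_exponent:
  assumes U: "up_closed U" and a: "a \<in> min_exponents U"
  shows "residual_point (monom_span (U - {a})) (monom_span U) = (0, 0)"
  unfolding residual_point_def
proof (rule the_equality)
  show "iso_Rmod (quot_Rmod (monom_span U) (monom_span (U - {a}))) (quot_Rmod UNIV (max_ideal (0, 0)))"
    by (rule iso_Rmod_remove_min_exponent[OF U a])
next
  fix p assume iso: "iso_Rmod (quot_Rmod (monom_span U) (monom_span (U - {a})))
    (quot_Rmod UNIV (max_ideal p))"
  have aU: "a \<in> U" using a min_exponents_subset by blast
  have I: "ideal (monom_span (U - {a})) Rxy"
    using up_closed_remove_iff[OF U aU] a by (simp add: ideal_monom_span)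
  have kill: "xy_monom c * f \<in> monom_span (U - {a})" if "c \<noteq> 0" "f \<in> monom_span U" for c f
  proof -
    have "xy_monom c * f \<in> monom_span (U - min_exponents U)"
      using that by (intro mult_monom_span_min[OF U]) simp_all
    then show ?thesis using a by (auto simp: monom_span_def)
  qed
  have "eval_xy (xy_monom c) p = 0" if "c \<noteq> 0" for c
    using iso_Rmod_annihilator[OF I iso] kill[OF that] by blast
  from this[of "(1, 0)"] this[of "(0, 1)"] show "p = (0, 0)"
    by (simp add: zero_prod_def xy_monom_def eval_xy_single prod_eq_iff)
qed


section \<open>Minimal generators and fixed points of the fibre\<close>

theorem proposition5p11:
  fixes J :: "poly_xy set" and \<mu> :: "nat list" and n :: nat
  assumes "is_partition \<mu>"
    and "J = partition_ideal \<mu>"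
    and "has_colength J n"
  shows "zero_locus J \<subseteq> {(0, 0)} \<and>
    vectorspace class_ring (quot_space J (m_times J)) \<and>
    inj_on (\<lambda>f. m_times J +>\<^bsub>Rxy\<^esub> f) (min_monomial_gens J) \<and>
    vectorspace.basis class_ring (quot_space J (m_times J))
      ((\<lambda>f. m_times J +>\<^bsub>Rxy\<^esub> f) ` min_monomial_gens J) \<and>
    bij_betw xy_monom (addable_boxes \<mu>) (min_monomial_gens J) \<and>
    bij_betw (\<lambda>a. (ideal_outside (insert a (young_diagram \<mu>)), J))
      (addable_boxes \<mu>) (torus_fixed (phi_fibre n (J, (0, 0))))"
proof -
  define D where "D = young_diagram \<mu>"
  define U where "U = - D"
  define A where "A = min_exponents U"
  define V where "V = U - A"
  have finD: "finite D" by (simp add: D_def finite_young_diagram)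
  have U: "up_closed U"
    unfolding U_def D_def using assms(1) by (rule up_closed_compl_young_diagram)
  have J: "J = monom_span U"
    using U by (simp add: assms(2) partition_ideal_def ideal_outside_eq_monom_span U_def D_def)
  have JI: "ideal J Rxy" by (simp add: J ideal_monom_span U)
  have addable: "addable_boxes \<mu> = A"
    by (simp add: addable_boxes_eq_min_exponents[OF assms(1)] A_def U_def D_def)
  have gens: "min_monomial_gens J = xy_monom ` A"
    by (simp add: J min_monomial_gens_monom_span[OF U] A_def)
  have mJ: "m_times J = monom_span V"
    by (simp add: J m_times_monom_span[OF U] V_def A_def)
  have AU: "A \<subseteq> U" by (simp add: A_def min_exponents_subset)
  have V: "up_closed V"
    unfolding V_def A_def using U by (rule up_closed_non_min)
  have UV: "U - V = A" using AU by (auto simp: V_def)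
  have card: "card D = n"
    using assms(3) has_colength_monom_span_iff[OF U] by (simp add: J U_def)
  have zero: "zero_locus J \<subseteq> {(0, 0)}"
    unfolding J by (rule monom_span_zero_locus) (simp add: U_def finD)
  have vs: "vectorspace class_ring (quot_space J (m_times J))"
    unfolding J mJ[unfolded J] by (rule vectorspace_quot_space) (simp_all add: ideal_monom_span U V)
  have inj: "inj_on (\<lambda>f. m_times J +>\<^bsub>Rxy\<^esub> f) (min_monomial_gens J)"
  proof -
    have "inj_on (\<lambda>b. monom_span V +>\<^bsub>Rxy\<^esub> xy_monom b) A"
      using inj_on_monomial_cosets[OF V] by (rule inj_on_subset) (auto simp: V_def)
    then show ?thesis
      unfolding gens mJ by (auto simp: inj_on_def)
  qed
  have basis: "vectorspace.basis class_ring (quot_space J (m_times J))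
      ((\<lambda>f. m_times J +>\<^bsub>Rxy\<^esub> f) ` min_monomial_gens J)"
    unfolding mJ gens image_image using basis_monomial_cosets[OF U V] by (simp only: UV J)
  have boxes: "bij_betw xy_monom (addable_boxes \<mu>) (min_monomial_gens J)"
    unfolding addable gens using inj_on_subset[OF inj_xy_monom subset_UNIV]
    by (simp add: bij_betw_def)
  have remove: "up_closed (U - {a})" "ideal_outside (insert a D) = monom_span (U - {a})"
    if a: "a \<in> A" for a
  proof -
    have "a \<in> U" using a AU by blast
    then show up: "up_closed (U - {a})"
      using a up_closed_remove_iff[OF U] unfolding A_def by metis
    have "- insert a D = U - {a}" by (auto simp: U_def)
    then show "ideal_outside (insert a D) = monom_span (U - {a})"
      using ideal_outside_eq_monom_span[of "insert a D"] up by simp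
  qed
  have fibre: "bij_betw (\<lambda>a. (ideal_outside (insert a D), J)) A
      (torus_fixed (phi_fibre n (J, (0, 0))))"
  proof (rule bij_betw_imageI)
    show "inj_on (\<lambda>a. (ideal_outside (insert a D), J)) A"
    proof (rule inj_onI)
      fix a b assume ab: "a \<in> A" "b \<in> A"
        and "(ideal_outside (insert a D), J) = (ideal_outside (insert b D), J)"
      then have "U - {a} = U - {b}" by (simp add: remove)
      then show "a = b" using ab AU by blast
    qed
    have "(monom_span (U - {a}), J) \<in> torus_fixed (phi_fibre n (J, (0, 0)))" if a: "a \<in> A" for a
    proof -
      have "- (U - {a}) = insert a D" "a \<notin> D" using a AU by (auto simp: U_def)
      then have "has_colength (monom_span (U - {a})) (n + 1)"
        using remove(1)[OF a] by (simp add: has_colength_monom_span_iff finD card)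
      then have "(monom_span (U - {a}), J) \<in> nested_hilb n"
        using assms(3) JI remove(1)[OF a] monom_span_mono[of "U - {a}" U]
        by (auto simp: nested_hilb_def hilb_def ideal_monom_span J)
      moreover have "residual_point (monom_span (U - {a})) J = (0, 0)"
        using residual_point_remove_min_exponent[OF U] a by (simp add: J A_def)
      ultimately show ?thesis
        by (simp add: torus_fixed_def phi_fibre_def hilb_phi_def torus_act_pair_def
            torus_act_monom_span J)
    qed
    moreover have "P \<in> (\<lambda>a. (monom_span (U - {a}), J)) ` A"
      if P: "P \<in> torus_fixed (phi_fibre n (J, (0, 0)))" for P
    proof -
      obtain I where I: "P = (I, J)" "ideal I Rxy" "has_colength I (n + 1)" "I \<subseteq> J"
        and stable: "\<And>\<tau>. \<tau> \<in> torus \<Longrightarrow> torus_act \<tau> ` I \<subseteq> I"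
        using P by (cases P) (auto simp: torus_fixed_def phi_fibre_def nested_hilb_def hilb_def
            hilb_phi_def torus_act_pair_def)
      obtain W where W: "up_closed W" "I = monom_span W"
        using torus_stable_ideal_eq_monom_span[OF I(2) stable] by blast
      have "W \<subseteq> U"
        using I(4) xy_monom_in_monom_span unfolding W(2) J by blast
      then have "D \<subseteq> - W" by (auto simp: U_def)
      moreover have "finite (- W)" "card (- W) = n + 1"
        using I(3) W has_colength_monom_span_iff by auto
      ultimately have "card (- W - D) = 1"
        using card by (simp add: card_Diff_subset finD)
      then obtain a where "- W - D = {a}" by (auto simp: card_1_singleton_iff)
      then have a: "a \<in> U" "W = U - {a}"
        using \<open>W \<subseteq> U\<close> by (auto simp: U_def)
      then have "a \<in> A"
        using W(1) up_closed_remove_iff[OF U a(1)] unfolding A_def by simp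
      then show ?thesis using I(1) W(2) a(2) by blast
    qed
    ultimately have "(\<lambda>a. (monom_span (U - {a}), J)) ` A = torus_fixed (phi_fibre n (J, (0, 0)))"
      by blast
    then show "(\<lambda>a. (ideal_outside (insert a D), J)) ` A = torus_fixed (phi_fibre n (J, (0, 0)))"
      by (simp add: remove cong: image_cong)
  qed
  show ?thesis
    using zero vs inj basis boxes fibre by (simp add: addable D_def)
qed

end
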